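(* Let $S \subseteq \mathbb{Z}^+$ be permutable and let $F \subseteq S$ be finite. There is no infinite sequence $u_0 < u_1 < u_2 < \cdots$ of elements of $S$ such that for every $k \ge 0$ one has $u_{k+1} = 2u_k - f_k$ for some $f_k \in F$.
   Context: $\mathbb{N} = \{1,2,3,\dots\} = \mathbb{Z}^+$. A set $S \subseteq \mathbb{Z}^+$ is permutable if there is a bijection $\pi\colon \mathbb{N} \to S$ such that no $i<j<k$ have $\pi(i),\pi(j),\pi(k)$ forming an arithmetic progression with $\pi(i)<\pi(j)<\pi(k)$ or $\pi(i)>\pi(j)>\pi(k)$. *)

theory Defs
  imports Main
begin

definition arith_prog3 :: "int \<Rightarrow> int \<Rightarrow> int \<Rightarrow> bool" where
  "arith_prog3 a b c \<longleftrightarrow> b - a = c - b"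

(* Positions are positive naturals; the entries are integers so that subtraction does not
   truncate.  Positivity of the elements of S is assumed separately. *)
definition permutable :: "int set \<Rightarrow> bool" where
  "permutable S \<longleftrightarrow>
    (\<exists>\<pi> :: nat \<Rightarrow> int. bij_betw \<pi> {1..} S \<and>
      \<not> (\<exists>i\<ge>1. \<exists>j>i. \<exists>k>j. arith_prog3 (\<pi> i) (\<pi> j) (\<pi> k) \<and>
            (\<pi> i < \<pi> j \<and> \<pi> j < \<pi> k \<or> \<pi> i > \<pi> j \<and> \<pi> j > \<pi> k)))"

end

(* If u_k is enumerated after every element of F, then the increasing progression
   f_k, u_k, u_(k+1) forces u_(k+1) to be enumerated before u_k.  All but finitely many u_k are
   enumerated after F, so the positions of the u_k would eventually decrease forever. *)
theory Submission
  imports Defs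
begin

theorem lemma4:
  fixes S F :: "int set"
  assumes "S \<subseteq> {1..}"
    and "permutable S"
    and "F \<subseteq> S"
    and "finite F"
  shows "\<not> (\<exists>u :: nat \<Rightarrow> int. strict_mono u \<and> range u \<subseteq> S \<and>
              (\<forall>k. \<exists>f\<in>F. u (Suc k) = 2 * u k - f))"
proof
  assume "\<exists>u :: nat \<Rightarrow> int. strict_mono u \<and> range u \<subseteq> S \<and>
              (\<forall>k. \<exists>f\<in>F. u (Suc k) = 2 * u k - f)"
  then obtain u :: "nat \<Rightarrow> int" where u: "strict_mono u" "\<And>k. u k \<in> S"
    and step: "\<And>k. \<exists>f\<in>F. u (Suc k) = 2 * u k - f"
    by blast
  obtain \<pi> :: "nat \<Rightarrow> int" where bij: "bij_betw \<pi> {1..} S"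
    and avoid: "\<And>i j k. \<lbrakk>1 \<le> i; i < j; j < k; arith_prog3 (\<pi> i) (\<pi> j) (\<pi> k);
                  \<pi> i < \<pi> j; \<pi> j < \<pi> k\<rbrakk> \<Longrightarrow> False"
    using assms(2) unfolding permutable_def by blast
  \<comment> \<open>\<open>p x\<close> is the position at which the enumeration \<open>\<pi>\<close>
    lists \<open>x\<close>.\<close>
  define p where "p = inv_into {1..} \<pi>"
  have p: "1 \<le> p x" "\<pi> (p x) = x" if "x \<in> S" for x
    using that bij inv_into_into[of x \<pi> "{1..}"] f_inv_into_f[of x \<pi> "{1..}"]
    by (auto simp: p_def bij_betw_def)
  obtain M where M: "\<And>f. f \<in> F \<Longrightarrow> p f \<le> M"
    using finite_imageI[OF assms(4), of p] by (auto simp: finite_nat_set_iff_bounded_le)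
  \<comment> \<open>Distinct terms of \<open>u\<close> have distinct positions, so only finitely
    many can sit at positions up to \<open>M\<close>; \<open>K\<close> lies beyond all their
    indices.\<close>
  have "inj (\<lambda>k. p (u k))"
    by (rule injI) (metis p(2) u strict_mono_eq)
  then have "finite {k. p (u k) \<le> M}"
    using finite_vimageI[of "{..M}"] by (simp add: vimage_def)
  then obtain K where "\<And>k. p (u k) \<le> M \<Longrightarrow> k < K"
    by (auto simp: finite_nat_set_iff_bounded)
  then have late: "M < p (u k)" if "K \<le> k" for k
    using that by (meson leD not_le)
  have descent: "p (u (Suc k)) < p (u k)" if "K \<le> k" for k
  proof (rule ccontr)
    assume not_less: "\<not> p (u (Suc k)) < p (u k)"
    obtain f where f: "f \<in> F" "u (Suc k) = 2 * u k - f"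
      using step by blast
    have lt: "u k < u (Suc k)"
      using u(1) by (simp add: strict_mono_Suc_iff)
    \<comment> \<open>Equal positions would force equal values, so the negated inequality becomes
      strict in the other direction.\<close>
    have "p (u k) \<noteq> p (u (Suc k))"
      by (metis lt p(2) u(2) less_irrefl)
    then have "p (u k) < p (u (Suc k))"
      using not_less by simp
    moreover have "p f < p (u k)"
      using M[OF f(1)] late[OF that] by simp
    moreover have "f \<in> S"
      using f(1) assms(3) by blast
    \<comment> \<open>The common difference is \<open>u k - f = u (Suc k) - u k\<close>, which is
      positive because \<open>u\<close> increases; hence \<open>f < u k\<close>.\<close>
    moreover have "arith_prog3 f (u k) (u (Suc k))" "f < u k"
      using f(2) lt by (simp_all add: arith_prog3_def)
    ultimately show False
      using avoid[of "p f" "p (u k)" "p (u (Suc k))"] lt p(1)[of f] by (simp add: p(2) u(2))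
  qed
  \<comment> \<open>A term of least position among those with index at least \<open>K\<close>; by
    \<open>descent\<close> its successor, also in that range, has a smaller position.\<close>
  obtain k where "K \<le> k" and least: "\<And>l. K \<le> l \<Longrightarrow> p (u k) \<le> p (u l)"
    using ex_has_least_nat[of "(\<le>) K" K "\<lambda>k. p (u k)"] by auto
  then show False
    by (metis descent le_SucI not_le)
qed

end
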